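(* Let $G$ be a graph, $\mathcal C$ a hole cover of $G$, $(\mathcal C_1,\dots,\mathcal C_\ell)$ a local chordalization partition of $\mathcal C$, and $G^*=G_\ell^*$ the last graph of the corresponding chordalization chain. If $K\subseteq V(G)$ is a clique in $G^*$, then there is a subset $\mathcal C^*\subseteq K\cap\mathcal C$ such that $K\setminus\mathcal C^*$ is a clique in $G$ and $|\mathcal C^*\cap\mathcal C_i|\le 1$ for each $i=1,\dots,\ell$.
   Context: All graphs are finite and simple. A hole of $G$ is an induced cycle of length at least $4$; $G$ is chordal if it has no hole. $\mathcal H(G)$ is the set of holes and $\mathcal H(G,u)$ those containing $u$. A hole cover of $G$ is a nonempty $X\subseteq V(G)$ meeting every hole (any nonempty set if $G$ is chordal). A vertex $u$ satisfies the NC property in $G$ if there are no holes $H\in\mathcal H(G,u)$, $H'\in\mathcal H(G)\setminus\mathcal H(G,u)$ sharing two consecutive edges (two distinct edges with a common end vertex lying on both). A set $\mathcal C$ satisfies the NC property in $G$ if each of its vertices does and every hole contains at most one vertex of $\mathcal C$. Locally chordalizing all holes in $\mathcal H(G,u)$ by $u$ means adding all edges $uw$ with $w\ne u$ lying on some hole in $\mathcal H(G,u)$. For a hole cover $\mathcal C=\{u_1,\dots,u_k\}$ satisfying the NC property in $G$, set $G_0=G$, obtain $G_i$ from $G_{i-1}$ by locally chordalizing all holes in $\mathcal H(G_{i-1},u_i)$ by $u_i$, and put $\widehat G(\mathcal C)=G_k$ (independent of the ordering). Given a hole cover $\mathcal C$ of $G$, an ordered partition $(\mathcal C_1,\dots,\mathcal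 C_\ell)$ of $\mathcal C$ into nonempty parts is a local chordalization partition if, with $G_0=G_0^*=G-\mathcal C$ and, for $i=1,\dots,\ell$, $G_i$ the graph with $V(G_i)=V(G_{i-1}^* )\cup\mathcal C_i$ and $E(G_i)=E(G_{i-1}^* )\cup E\big(G-\bigcup_{j=i+1}^{\ell}\mathcal C_j\big)$ and $G_i^*=\widehat{G_i}(\mathcal C_i)$, each $\mathcal C_i$ is a hole cover of $G_i$ satisfying the NC property in $G_i$ and each $G_i^*$ is chordal. The sequence $G_0,G_0^*,\dots,G_\ell,G_\ell^*$ is the chordalization chain. *)

theory Defs
  imports Main
begin

type_synonym 'a graph = "'a set \<times> 'a set set"

definition verts :: "'a graph \<Rightarrow> 'a set" where "verts G = fst G"
definition edges :: "'a graph \<Rightarrow> 'a set set" where "edges G = snd G"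

definition simple_graph :: "'a graph \<Rightarrow> bool" where
  "simple_graph G \<longleftrightarrow> finite (verts G) \<and>
     (\<forall>e\<in>edges G. \<exists>u v. e = {u, v} \<and> u \<noteq> v \<and> u \<in> verts G \<and> v \<in> verts G)"

definition adj :: "'a graph \<Rightarrow> 'a \<Rightarrow> 'a \<Rightarrow> bool" where
  "adj G u v \<longleftrightarrow> u \<noteq> v \<and> {u, v} \<in> edges G"

definition del_verts :: "'a graph \<Rightarrow> 'a set \<Rightarrow> 'a graph" where
  "del_verts G S = (verts G - S, {e \<in> edges G. e \<inter> S = {}})"

definition clique :: "'a graph \<Rightarrow> 'a set \<Rightarrow> bool" where
  "clique G K \<longleftrightarrow> (\<forall>u\<in>K. \<forall>v\<in>K. u \<noteq> v \<longrightarrow> adj G u v)"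

text \<open>A hole (induced cycle of length at least 4), identified with its vertex set;
  since it is induced, its edges are exactly the edges of G inside it.\<close>
definition is_hole :: "'a graph \<Rightarrow> 'a set \<Rightarrow> bool" where
  "is_hole G H \<longleftrightarrow> (\<exists>vs. set vs = H \<and> distinct vs \<and> length vs \<ge> 4 \<and> H \<subseteq> verts G \<and>
     (\<forall>i<length vs. \<forall>j<length vs.
        adj G (vs ! i) (vs ! j) \<longleftrightarrow> (j = Suc i mod length vs \<or> i = Suc j mod length vs)))"

definition holes :: "'a graph \<Rightarrow> 'a set set" where
  "holes G = {H. is_hole G H}"

definition holes_at :: "'a graph \<Rightarrow> 'a \<Rightarrow> 'a set set" where
  "holes_at G u = {H \<in> holes G. u \<in> H}"

definition hole_edges :: "'a graph \<Rightarrow> 'a set \<Rightarrow> 'a set set" where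
  "hole_edges G H = {e \<in> edges G. e \<subseteq> H}"

definition chordal :: "'a graph \<Rightarrow> bool" where
  "chordal G \<longleftrightarrow> holes G = {}"

definition hole_cover :: "'a graph \<Rightarrow> 'a set \<Rightarrow> bool" where
  "hole_cover G X \<longleftrightarrow> X \<noteq> {} \<and> X \<subseteq> verts G \<and> (\<forall>H\<in>holes G. H \<inter> X \<noteq> {})"

definition NC_vertex :: "'a graph \<Rightarrow> 'a \<Rightarrow> bool" where
  "NC_vertex G u \<longleftrightarrow> \<not> (\<exists>H\<in>holes_at G u. \<exists>H'\<in>holes G - holes_at G u. \<exists>e1 e2.
      e1 \<noteq> e2 \<and> e1 \<inter> e2 \<noteq> {} \<and>
      e1 \<in> hole_edges G H \<inter> hole_edges G H' \<and> e2 \<in> hole_edges G H \<inter> hole_edges G H')"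

definition NC_set :: "'a graph \<Rightarrow> 'a set \<Rightarrow> bool" where
  "NC_set G C \<longleftrightarrow> (\<forall>u\<in>C. NC_vertex G u) \<and> (\<forall>H\<in>holes G. card (H \<inter> C) \<le> 1)"

definition local_chordalize :: "'a graph \<Rightarrow> 'a \<Rightarrow> 'a graph" where
  "local_chordalize G u =
     (verts G, edges G \<union> {{u, w} | w. w \<noteq> u \<and> w \<in> \<Union>(holes_at G u)})"

text \<open>\<open>\<widehat>G(C)\<close>: chordalize successively along an (arbitrarily chosen) enumeration of C;
  the paper states the result is independent of the ordering.\<close>
definition hat :: "'a graph \<Rightarrow> 'a set \<Rightarrow> 'a graph" where
  "hat G C = foldl local_chordalize G (SOME xs. set xs = C \<and> distinct xs)"

text \<open>Chordalization chain for an ordered partition given as a list Cs = [C_1,...,C_l]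
  (list index i corresponds to C_{i+1}). chain_G G Cs i = G_i, chain_Gstar G Cs i = G_i^*.\<close>
fun chain_Gstar :: "'a graph \<Rightarrow> 'a set list \<Rightarrow> nat \<Rightarrow> 'a graph"
and chain_G :: "'a graph \<Rightarrow> 'a set list \<Rightarrow> nat \<Rightarrow> 'a graph" where
  "chain_G G Cs 0 = del_verts G (\<Union>(set Cs))"
| "chain_Gstar G Cs 0 = del_verts G (\<Union>(set Cs))"
| "chain_G G Cs (Suc i) =
     (verts (chain_Gstar G Cs i) \<union> Cs ! i,
      edges (chain_Gstar G Cs i) \<union>
        edges (del_verts G (\<Union>{Cs ! j | j. i < j \<and> j < length Cs})))"
| "chain_Gstar G Cs (Suc i) = hat (chain_G G Cs (Suc i)) (Cs ! i)"

definition ordered_partition :: "'a set \<Rightarrow> 'a set list \<Rightarrow> bool" where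
  "ordered_partition C Cs \<longleftrightarrow> (\<forall>i<length Cs. Cs ! i \<noteq> {}) \<and>
     (\<forall>i<length Cs. \<forall>j<length Cs. i \<noteq> j \<longrightarrow> Cs ! i \<inter> Cs ! j = {}) \<and>
     \<Union>(set Cs) = C"

definition local_chordalization_partition :: "'a graph \<Rightarrow> 'a set \<Rightarrow> 'a set list \<Rightarrow> bool" where
  "local_chordalization_partition G C Cs \<longleftrightarrow> hole_cover G C \<and> ordered_partition C Cs \<and>
     (\<forall>i<length Cs. hole_cover (chain_G G Cs (Suc i)) (Cs ! i) \<and>
                    NC_set (chain_G G Cs (Suc i)) (Cs ! i) \<and>
                    chordal (chain_Gstar G Cs (Suc i)))"

end

theory Submission
  imports Defs
begin

text \<open>
  The crux is that chordalizing at a vertex \<open>u\<close> with the NC property creates no new hole. A new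
  hole would pass through \<open>u\<close> and consist otherwise of two vertices \<open>w\<close>, \<open>x\<close> that are neighbours of
  \<open>u\<close> or lie on old holes at \<open>u\<close>, joined by a path \<open>Q\<close> that avoids both kinds of vertices. If \<open>w\<close>
  and \<open>x\<close> were nonadjacent, following the old holes from \<open>w\<close> and from \<open>x\<close> towards \<open>u\<close> would produce
  either a hole at \<open>u\<close> meeting \<open>Q\<close>, or a hole avoiding \<open>u\<close> that shares two consecutive edges with
  an old hole at \<open>u\<close>; both are impossible. Hence every edge of \<open>hat G C\<close> that is not in \<open>G\<close> joins
  some \<open>u \<in> C\<close> to a vertex on a hole of \<open>G\<close> at \<open>u\<close>.

  If a clique of \<open>hat G C\<close> contained such edges at two vertices \<open>u\<close>, \<open>v\<close> of \<open>C\<close>, then \<open>G\<close> would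
  contain a hole through both \<open>u\<close> and \<open>v\<close>: a 4-cycle, or a hole through the edge \<open>uv\<close> that follows a
  hole at \<open>u\<close> and a hole at \<open>v\<close> up to a common vertex. So deleting one vertex of \<open>C\<close> from the clique
  suffices, and the theorem follows by descending the chain, where edges of \<open>G\<^sub>i\<close> meeting \<open>C\<^sub>i\<close> are
  edges of \<open>G\<close>.
\<close>

lemma adj_commute: "adj G a b \<longleftrightarrow> adj G b a"
  by (auto simp: adj_def insert_commute)

lemma adj_irrefl [simp]: "\<not> adj G a a"
  by (simp add: adj_def)

subsection \<open>Connectivity inside a vertex set\<close>

text \<open>By reflexivity \<open>reach G S a a\<close> also holds for \<open>a\<close> outside
  \<open>S\<close>; only distinct endpoints are forced into \<open>S\<close>.\<close>

definition reach :: "'a graph \<Rightarrow> 'a set \<Rightarrow> 'a \<Rightarrow> 'a \<Rightarrow> bool" where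
  "reach G S = (\<lambda>x y. x \<in> S \<and> y \<in> S \<and> adj G x y)\<^sup>*\<^sup>*"

definition connected_in :: "'a graph \<Rightarrow> 'a set \<Rightarrow> bool" where
  "connected_in G X \<longleftrightarrow> (\<forall>x\<in>X. \<forall>y\<in>X. reach G X x y)"

text \<open>Membership counts as touching, so an attachment point may itself belong to the
  connecting set \<open>X\<close>.\<close>

definition touches :: "'a graph \<Rightarrow> 'a set \<Rightarrow> 'a \<Rightarrow> bool" where
  "touches G X y \<longleftrightarrow> y \<in> X \<or> (\<exists>x\<in>X. adj G x y)"

lemma reach_refl [simp]: "reach G S a a"
  by (simp add: reach_def)

lemma reach_step: "a \<in> S \<Longrightarrow> b \<in> S \<Longrightarrow> adj G a b \<Longrightarrow> reach G S a b"
  by (auto simp: reach_def)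

lemma reach_trans: "reach G S a b \<Longrightarrow> reach G S b c \<Longrightarrow> reach G S a c"
  unfolding reach_def by (rule rtranclp_trans)

lemma reach_mono:
  assumes "reach G S a b" "S \<subseteq> T"
  shows "reach G T a b"
  using assms(1) unfolding reach_def
  by (rule rtranclp_mono[THEN predicate2D, rotated]) (use assms(2) in auto)

lemma reach_sym: "reach G S a b \<Longrightarrow> reach G S b a"
  unfolding reach_def
proof (induction rule: rtranclp_induct)
  case (step y z)
  then have "z \<in> S \<and> y \<in> S \<and> adj G z y" by (simp add: adj_commute)
  then show ?case using step.IH by (rule converse_rtranclp_into_rtranclp)
qed simp

text \<open>Serves as a separation argument: a walk that ends outside \<open>A\<close> must leave
  \<open>A\<close> along an edge inside \<open>S\<close>.\<close>

lemma reach_invariant: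
  assumes "reach G S a b" "a \<in> A"
    and "\<And>x y. x \<in> A \<Longrightarrow> x \<in> S \<Longrightarrow> y \<in> S \<Longrightarrow> adj G x y \<Longrightarrow> y \<in> A"
  shows "b \<in> A"
  using assms(1) unfolding reach_def
  by (induction rule: rtranclp_induct) (use assms(2,3) in auto)

lemma connected_in_singleton [simp]: "connected_in G {x}"
  by (simp add: connected_in_def)

lemma connected_in_Un:
  assumes "connected_in G X" "connected_in G Y" "x \<in> X" "y \<in> Y" "adj G x y"
  shows "connected_in G (X \<union> Y)"
proof -
  have from_x: "reach G (X \<union> Y) x z" if "z \<in> X \<union> Y" for z
  proof (cases "z \<in> X")
    case True
    then show ?thesis
      using assms(1,3) by (auto simp: connected_in_def intro: reach_mono)
  next
    case False
    then have "reach G (X \<union> Y) y z"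
      using assms(2,4) that by (auto simp: connected_in_def intro: reach_mono)
    moreover have "reach G (X \<union> Y) x y"
      using assms(3-5) by (intro reach_step) auto
    ultimately show ?thesis by (rule reach_trans[rotated])
  qed
  then show ?thesis
    unfolding connected_in_def by (meson reach_sym reach_trans)
qed

lemma connected_in_reach_touches:
  assumes "connected_in G X" "touches G X a" "touches G X b"
  shows "reach G (insert a (insert b X)) a b"
proof -
  let ?S = "insert a (insert b X)"
  have "\<exists>x\<in>X. reach G ?S a x"
    using assms(2) unfolding touches_def
    by (meson adj_commute insertCI reach_refl reach_step)
  moreover have "\<exists>y\<in>X. reach G ?S y b"
    using assms(3) unfolding touches_def
    by (meson insertCI reach_refl reach_step)
  ultimately obtain x y where xy: "x \<in> X" "y \<in> X" "reach G ?S a x" "reach G ?S y b"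
    by blast
  moreover have "reach G ?S x y"
    using xy assms(1) by (auto simp: connected_in_def intro: reach_mono)
  ultimately show ?thesis
    by (meson reach_trans)
qed

subsection \<open>Holes as a vertex plus an induced path\<close>

text \<open>The cycle is cut open at the apex \<open>u\<close>. It has \<open>n + 2\<close>
  vertices, so \<open>2 \<le> n\<close> encodes length at least 4; the inner vertices
  \<open>d k\<close> with \<open>0 < k < n\<close> are those that chordalizing at \<open>u\<close>
  newly joins to \<open>u\<close>.\<close>

definition hole_path :: "'a graph \<Rightarrow> 'a \<Rightarrow> nat \<Rightarrow> (nat \<Rightarrow> 'a) \<Rightarrow> bool" where
  "hole_path G u n d \<longleftrightarrow> 2 \<le> n \<and> u \<in> verts G \<and> d ` {..n} \<subseteq> verts G \<and> u \<notin> d ` {..n} \<and>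
     inj_on d {..n} \<and> (\<forall>i\<le>n. adj G u (d i) \<longleftrightarrow> i = 0 \<or> i = n) \<and>
     (\<forall>i\<le>n. \<forall>j\<le>n. adj G (d i) (d j) \<longleftrightarrow> j = Suc i \<or> i = Suc j)"

lemma hole_path_adj:
  "hole_path G u n d \<Longrightarrow> i \<le> n \<Longrightarrow> j \<le> n \<Longrightarrow> adj G (d i) (d j) \<longleftrightarrow> j = Suc i \<or> i = Suc j"
  by (simp add: hole_path_def)

lemma hole_path_apex_adj:
  "hole_path G u n d \<Longrightarrow> i \<le> n \<Longrightarrow> adj G u (d i) \<longleftrightarrow> i = 0 \<or> i = n"
  by (simp add: hole_path_def)

lemma hole_path_eq:
  "hole_path G u n d \<Longrightarrow> i \<le> n \<Longrightarrow> j \<le> n \<Longrightarrow> d i = d j \<longleftrightarrow> i = j"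
  by (auto simp: hole_path_def inj_on_def)

lemma hole_path_neq_apex: "hole_path G u n d \<Longrightarrow> i \<le> n \<Longrightarrow> d i \<noteq> u"
  by (force simp: hole_path_def)

lemma hole_path_verts: "hole_path G u n d \<Longrightarrow> i \<le> n \<Longrightarrow> d i \<in> verts G"
  by (auto simp: hole_path_def)

text \<open>Transfers every result on the arc from \<open>d 0\<close> to \<open>d k\<close> to the
  arc from \<open>d k\<close> to \<open>d n\<close>.\<close>

lemma hole_path_reverse:
  assumes "hole_path G u n d"
  shows "hole_path G u n (\<lambda>i. d (n - i))"
proof -
  have "(\<lambda>i. d (n - i)) ` {..n} = d ` {..n}"
  proof -
    have "x \<in> (-) n ` {..n}" if "x \<le> n" for x
      using that by (intro image_eqI[of _ _ "n - x"]) auto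
    then have "(-) n ` {..n} = {..n}" by auto
    then show ?thesis by (metis image_image)
  qed
  moreover have "x = y" if "x \<le> n" "y \<le> n" "d (n - x) = d (n - y)" for x y
    using hole_path_eq[OF assms, of "n - x" "n - y"] that by auto
  then have "inj_on (\<lambda>i. d (n - i)) {..n}"
    by (auto simp: inj_on_def)
  ultimately show ?thesis
    using assms unfolding hole_path_def by auto
qed

lemma is_hole_insert_path:
  assumes d: "hole_path G u n d"
  shows "insert u (d ` {..n}) \<in> holes G"
proof -
  define vs where "vs = u # map d [0..<Suc n]"
  have len: "length vs = Suc (Suc n)" by (simp add: vs_def)
  have nth: "vs ! i = (case i of 0 \<Rightarrow> u | Suc j \<Rightarrow> d j)" if "i < Suc (Suc n)" for i
    using that by (auto simp: vs_def nth_append split: nat.split)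
      (use less_SucE nth_map_upt in force)+
  have n: "2 \<le> n" using d by (simp add: hole_path_def)
  have adj: "adj G (vs ! i) (vs ! j) \<longleftrightarrow> j = Suc i mod length vs \<or> i = Suc j mod length vs"
    if ij: "i < length vs" "j < length vs" for i j
  proof -
    have sm: "Suc k mod length vs = (if k = Suc n then 0 else Suc k)" if "k < length vs" for k
      using that len by auto
    show ?thesis
      using ij n hole_path_adj[OF d] hole_path_apex_adj[OF d]
      unfolding sm[OF ij(1)] sm[OF ij(2)]
      by (cases i; cases j) (auto simp: nth len adj_commute[of G _ u])
  qed
  have "set vs = insert u (d ` {..n})"
    by (auto simp: vs_def lessThan_Suc_atMost atLeast0LessThan simp del: upt_Suc)
  moreover have "distinct vs"
    using d by (auto simp: vs_def hole_path_def distinct_map inj_on_def simp del: upt_Suc)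
  ultimately show ?thesis
    unfolding holes_def is_hole_def using adj len n d
    by (intro CollectI exI[of _ vs]) (auto simp: hole_path_def)
qed

lemma hole_path_exists:
  assumes "H \<in> holes_at G u"
  obtains n d where "hole_path G u n d" "H = insert u (d ` {..n})"
proof -
  from assms obtain vs where vs: "set vs = H" "distinct vs" "length vs \<ge> 4" "H \<subseteq> verts G"
    and adj: "\<And>i j. i < length vs \<Longrightarrow> j < length vs \<Longrightarrow>
        adj G (vs ! i) (vs ! j) \<longleftrightarrow> (j = Suc i mod length vs \<or> i = Suc j mod length vs)"
    and u: "u \<in> H"
    unfolding holes_at_def holes_def is_hole_def by blast
  let ?L = "length vs"
  obtain m where m: "m < ?L" "vs ! m = u"
    using u vs(1) by (metis in_set_conv_nth)
  \<comment> \<open>Rotating the cyclic list puts \<open>u\<close> first; the other entries become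
    the path.\<close>
  define ws where "ws = rotate m vs"
  have L: "length ws = ?L" by (simp add: ws_def)
  have nth: "ws ! i = vs ! ((m + i) mod ?L)" if "i < ?L" for i
    using that by (simp add: ws_def nth_rotate add.commute)
  \<comment> \<open>The rotation shifts positions by \<open>m\<close> modulo the length, which
    cyclic adjacency does not notice.\<close>
  have cancel: "(m + a) mod ?L = (m + b) mod ?L \<longleftrightarrow> a mod ?L = b mod ?L" for a b
  proof (induction a b rule: linorder_wlog)
    case (le a b)
    then show ?case
      using mod_eq_dvd_iff_nat[of "m + a" "m + b" ?L] mod_eq_dvd_iff_nat[of a b ?L] by auto
  qed auto
  have adjw: "adj G (ws ! i) (ws ! j) \<longleftrightarrow> j = Suc i mod ?L \<or> i = Suc j mod ?L"
    if "i < ?L" "j < ?L" for i j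
  proof -
    have *: "(m + b) mod ?L = Suc ((m + a) mod ?L) mod ?L \<longleftrightarrow> b = Suc a mod ?L" if "b < ?L" for a b
      using cancel[of b "Suc a"] that by (simp add: mod_Suc_eq)
    have "?L > 0" using vs(3) by linarith
    then show ?thesis
      using that by (simp add: nth adj *)
  qed
  define d where "d i = ws ! Suc i" for i
  have dw: "distinct ws" and sw: "set ws = H" using vs by (auto simp: ws_def)
  have w0: "ws ! 0 = u" using nth[of 0] m by (cases vs) auto
  \<comment> \<open>One entry is the apex, and path positions run from 0 to \<open>n\<close>
    inclusive.\<close>
  define n where "n = ?L - 2"
  have Ln: "?L = Suc (Suc n)" using vs(3) by (simp add: n_def)
  have H: "H = insert u (d ` {..n})"
  proof -
    have "H = (!) ws ` {..<Suc (Suc n)}"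
      using sw L Ln by (auto simp: set_conv_nth)
    also have "\<dots> = insert (ws ! 0) ((\<lambda>i. ws ! Suc i) ` {..<Suc n})"
      by (simp only: lessThan_Suc_eq_insert_0 image_insert image_image)
    finally show ?thesis using w0 by (simp add: d_def lessThan_Suc_atMost)
  qed
  have notu: "u \<notin> d ` {..n}"
    using dw w0 L Ln by (auto simp: d_def) (metis Suc_mono le_imp_less_Suc nat.distinct(1) nth_eq_iff_index_eq zero_less_Suc)
  have "hole_path G u n d"
    unfolding hole_path_def
  proof (intro conjI allI impI)
    show "2 \<le> n" using vs(3) by (simp add: n_def)
    show "u \<in> verts G" "d ` {..n} \<subseteq> verts G" using H vs(4) by auto
    show "u \<notin> d ` {..n}" by fact
    show "inj_on d {..n}"
      using dw L Ln by (auto simp: d_def inj_on_def nth_eq_iff_index_eq)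
    show "adj G u (d i) \<longleftrightarrow> i = 0 \<or> i = n" if "i \<le> n" for i
      using adjw[of 0 "Suc i"] that Ln w0 by (auto simp: d_def mod_Suc)
    show "adj G (d i) (d j) \<longleftrightarrow> j = Suc i \<or> i = Suc j" if "i \<le> n" "j \<le> n" for i j
      using adjw[of "Suc i" "Suc j"] that Ln by (auto simp: d_def mod_Suc split: if_splits)
  qed
  then show thesis using H that by blast
qed

lemma hole_path_reach:
  assumes d: "hole_path G u n d" and ij: "i \<le> n" "j \<le> n" and S: "d ` {min i j..max i j} \<subseteq> S"
  shows "reach G S (d i) (d j)"
proof -
  have up: "reach G (d ` {i..j}) (d i) (d j)" if "i \<le> j" "j \<le> n" for i j
    using that
  proof (induction j rule: dec_induct)
    case (step j)
    have "reach G (d ` {i..Suc j}) (d i) (d j)"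
      using step by (auto intro: reach_mono)
    moreover have "reach G (d ` {i..Suc j}) (d j) (d (Suc j))"
      using step hole_path_adj[OF d, of j "Suc j"] by (intro reach_step) auto
    ultimately show ?case by (rule reach_trans)
  qed simp
  show ?thesis
  proof (cases "i \<le> j")
    case True
    then show ?thesis using up[of i j] ij S by (auto intro: reach_mono simp: min_def max_def)
  next
    case False
    then show ?thesis
      using up[of j i, THEN reach_sym] ij S by (auto intro: reach_mono simp: min_def max_def)
  qed
qed

text \<open>A shortest path from \<open>a\<close> to \<open>b\<close> inside \<open>S\<close> is induced and closes up at \<open>v\<close>.\<close>

lemma hole_through:
  assumes v: "v \<in> verts G" "adj G v a" "adj G v b" and ab: "a \<noteq> b" "\<not> adj G a b"
    and S: "S \<subseteq> verts G" "v \<notin> S" "a \<in> S" "reach G S a b"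
    and excl: "\<And>z. z \<in> S \<Longrightarrow> adj G v z \<Longrightarrow> z = a \<or> z = b"
  obtains H where "H \<in> holes G" "v \<in> H" "a \<in> H" "b \<in> H" "H \<subseteq> insert v S"
    "reach G (H - {v}) a b"
proof -
  define R where "R = (\<lambda>x y. x \<in> S \<and> y \<in> S \<and> adj G x y)"
  have ex: "\<exists>n. (R ^^ n) a b"
    using S(4) unfolding reach_def R_def by (rule rtranclp_imp_relpowp)
  define n where "n = (LEAST n. (R ^^ n) a b)"
  have n: "(R ^^ n) a b"
    unfolding n_def by (rule LeastI_ex[OF ex])
  have least: "\<not> (R ^^ m) a b" if "m < n" for m
    using not_less_Least that unfolding n_def .
  from n obtain f where f: "f 0 = a" "f n = b" "\<And>i. i < n \<Longrightarrow> R (f i) (f (Suc i))"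
    unfolding relpowp_fun_conv by blast
  have seg: "(R ^^ (j - i)) (f i) (f j)" if "i \<le> j" "j \<le> n" for i j
    unfolding relpowp_fun_conv using that f(3)
    by (intro exI[of _ "\<lambda>k. f (i + k)"]) auto
  have fS: "f i \<in> S" if "i \<le> n" for i
    using f(1) f(3)[of "i - 1"] S(3) that by (cases i) (auto simp: R_def)
  \<comment> \<open>An equality or chord between non-consecutive positions would give a shorter walk
    from \<open>a\<close> to \<open>b\<close>.\<close>
  have short: "j = Suc i" if "i < j" "j \<le> n" "f i = f j \<or> adj G (f i) (f j)" for i j
  proof (rule ccontr)
    assume "j \<noteq> Suc i"
    then have lt: "Suc i < j" using that by simp
    have i: "(R ^^ i) a (f i)" and j: "(R ^^ (n - j)) (f j) b"
      using seg[of 0 i] seg[of j n] that f by auto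
    show False
    proof (cases "f i = f j")
      case True
      then have "(R ^^ (i + (n - j))) a b" using i j by (auto simp: relpowp_add)
      moreover have "i + (n - j) < n" using that by simp
      ultimately show False using least by blast
    next
      case False
      then have "R (f i) (f j)" using that fS by (auto simp: R_def)
      then have "(R ^^ Suc i) a (f j)" by (rule relpowp_Suc_I[OF i])
      then have "(R ^^ (Suc i + (n - j))) a b" using j unfolding relpowp_add by blast
      moreover have "Suc i + (n - j) < n" using that lt by simp
      ultimately show False using least by blast
    qed
  qed
  have consec: "adj G (f i) (f (Suc i))" if "i < n" for i
    using f(3)[OF that] by (simp add: R_def)
  have neq: "f i \<noteq> f j" if "i < j" "j \<le> n" for i j
    using short[OF that] consec[of i] that by auto
  \<comment> \<open>No step would give \<open>a = b\<close>, a single step would make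
    \<open>a\<close> and \<open>b\<close> adjacent.\<close>
  have n2: "2 \<le> n"
    using f(1,2) consec[of 0] ab by (cases n; cases "n - 1") auto
  have path: "hole_path G v n f"
    unfolding hole_path_def
  proof (intro conjI allI impI)
    show "f ` {..n} \<subseteq> verts G" "v \<notin> f ` {..n}" using fS S by auto
    show "inj_on f {..n}"
      using neq by (auto simp: inj_on_def) (metis linorder_neqE_nat)
    show "adj G v (f i) \<longleftrightarrow> i = 0 \<or> i = n" if "i \<le> n" for i
      using excl[OF fS[OF that]] v f(1,2) neq[of 0 i] neq[of i n] that
      by (metis bot_nat_0.not_eq_extremum le_neq_implies_less order_refl)
    show "adj G (f i) (f j) \<longleftrightarrow> j = Suc i \<or> i = Suc j" if "i \<le> n" "j \<le> n" for i j
    proof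
      assume "adj G (f i) (f j)"
      then show "j = Suc i \<or> i = Suc j"
        using short[of i j] short[of j i] that adj_commute[of G "f i" "f j"]
        by (metis adj_irrefl linorder_neqE_nat)
    qed (use consec that in \<open>auto simp: adj_commute\<close>)
  qed (use n2 v in auto)
  have "reach G (insert v (f ` {..n}) - {v}) a b"
    using hole_path_reach[OF path, of 0 n] f(1,2) path
    by (auto simp: hole_path_def atMost_atLeast0)
  moreover have "a \<in> f ` {..n}" "b \<in> f ` {..n}" "f ` {..n} \<subseteq> S"
    using f(1,2) fS by auto
  ultimately show thesis
    using is_hole_insert_path[OF path] by (intro that[of "insert v (f ` {..n})"]) auto
qed

section \<open>Bypasses of a path vertex and detours through a connected set\<close>

lemma NC_vertexD:
  assumes "NC_vertex G c" "H1 \<in> holes G" "c \<in> H1" "H2 \<in> holes G" "c \<notin> H2"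
    and "{a, v, b} \<subseteq> H1" "{a, v, b} \<subseteq> H2" "adj G v a" "adj G v b" "a \<noteq> b"
  shows False
proof -
  have "{v, a} \<in> hole_edges G H1 \<inter> hole_edges G H2" "{v, b} \<in> hole_edges G H1 \<inter> hole_edges G H2"
    using assms by (auto simp: hole_edges_def adj_def)
  moreover have "{v, a} \<noteq> {v, b}" "{v, a} \<inter> {v, b} \<noteq> {}"
    using assms(10) by (auto simp: doubleton_eq_iff)
  moreover have "H1 \<in> holes_at G c" "H2 \<in> holes G - holes_at G c"
    using assms by (auto simp: holes_at_def)
  ultimately show False
    using assms(1) unfolding NC_vertex_def by metis
qed

text \<open>Removing \<open>d k\<close> splits the path into two arcs with no edge between them,
  which \<open>X\<close> reconnects. As \<open>X\<close> is far from \<open>d k\<close>, the only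
  neighbours of \<open>d k\<close> in the arcs and \<open>X\<close> are its two path neighbours, so
  a shortest connection closes to a hole at \<open>d k\<close>; it has to cross
  \<open>X\<close>.\<close>

lemma hole_path_bypass:
  assumes d: "hole_path G u n d" and k: "i < k" "k < j" "j \<le> n"
    and X: "X \<subseteq> verts G" "u \<notin> X" "connected_in G X"
    and far: "\<And>x. x \<in> X \<Longrightarrow> x \<noteq> d k \<and> \<not> adj G x (d k)"
    and t: "touches G X (d i)" "touches G X (d j)"
  obtains H where "H \<in> holes G" "u \<notin> H" "d (k - 1) \<in> H" "d k \<in> H" "d (Suc k) \<in> H" "H \<inter> X \<noteq> {}"
proof -
  define A where "A = d ` {..<k}"
  define B where "B = d ` {k<..n}"
  define S where "S = A \<union> B \<union> X"
  have AB: "y \<in> A" if "x \<in> A" "y \<in> A \<union> B" "adj G x y" for x y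
    using that k hole_path_adj[OF d] unfolding A_def B_def by auto
  have disj: "A \<inter> B = {}"
    using hole_path_eq[OF d] k unfolding A_def B_def by fastforce
  have in_A: "d i \<in> A" "d (k - 1) \<in> A" and in_B: "d j \<in> B" "d (Suc k) \<in> B"
    using k by (auto simp: A_def B_def)
  have "reach G S (d (k - 1)) (d i)"
    by (rule hole_path_reach[OF d]) (use k in \<open>auto simp: S_def A_def\<close>)
  moreover have "reach G S (d i) (d j)"
    using connected_in_reach_touches[OF X(3) t]
    by (rule reach_mono) (use in_A in_B in \<open>auto simp: S_def\<close>)
  moreover have "reach G S (d j) (d (Suc k))"
    by (rule hole_path_reach[OF d]) (use k in \<open>auto simp: S_def B_def\<close>)
  ultimately have reach: "reach G S (d (k - 1)) (d (Suc k))"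
    by (meson reach_trans)
  obtain H where H: "H \<in> holes G" "d k \<in> H" "d (k - 1) \<in> H" "d (Suc k) \<in> H" "H \<subseteq> insert (d k) S"
    "reach G (H - {d k}) (d (k - 1)) (d (Suc k))"
  proof (rule hole_through[of "d k" G "d (k - 1)" "d (Suc k)" S])
    show "d k \<in> verts G" using hole_path_verts[OF d] k by simp
    show "adj G (d k) (d (k - 1))" "adj G (d k) (d (Suc k))" "\<not> adj G (d (k - 1)) (d (Suc k))"
      using hole_path_adj[OF d] k by auto
    show "d (k - 1) \<noteq> d (Suc k)" using hole_path_eq[OF d] k by auto
    show "S \<subseteq> verts G" using X(1) hole_path_verts[OF d] k by (auto simp: S_def A_def B_def)
    show "d k \<notin> S" using far hole_path_eq[OF d] k by (force simp: S_def A_def B_def)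
    show "d (k - 1) \<in> S" using in_A by (simp add: S_def)
    show "z = d (k - 1) \<or> z = d (Suc k)" if "z \<in> S" "adj G (d k) z" for z
      using that far hole_path_adj[OF d] k adj_commute[of G z "d k"]
      by (auto simp: S_def A_def B_def)
  qed (use reach in auto)
  have "H \<inter> X \<noteq> {}"
  proof
    assume "H \<inter> X = {}"
    then have "H - {d k} \<subseteq> A \<union> B" using H(5) by (auto simp: S_def)
    then have "d (Suc k) \<in> A"
      by (intro reach_invariant[OF H(6) in_A(2)]) (use AB in blast)
    then show False using in_B disj by blast
  qed
  moreover have "u \<notin> insert (d k) S"
  proof -
    have "u \<notin> d ` {..n}" using d by (simp add: hole_path_def)
    moreover have "insert (d k) (A \<union> B) \<subseteq> d ` {..n}" using k by (auto simp: A_def B_def)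
    ultimately show ?thesis using X(2) by (auto simp: S_def)
  qed
  ultimately show thesis using that H by blast
qed

text \<open>The bypassing hole avoids \<open>u\<close> but shares both edges at \<open>d k\<close>
  with the given hole at \<open>u\<close>.\<close>

lemma NC_vertex_no_bypass:
  assumes "NC_vertex G u" and d: "hole_path G u n d" and k: "i < k" "k < j" "j \<le> n"
    and "X \<subseteq> verts G" "u \<notin> X" "connected_in G X"
    and "\<And>x. x \<in> X \<Longrightarrow> x \<noteq> d k \<and> \<not> adj G x (d k)"
    and "touches G X (d i)" "touches G X (d j)"
  shows False
proof -
  obtain H where H: "H \<in> holes G" "u \<notin> H" "{d (k - 1), d k, d (Suc k)} \<subseteq> H"
    using hole_path_bypass[OF assms(2-8) assms(9) assms(10,11)] by (metis bot.extremum insert_subsetI)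
  show False
  proof (rule NC_vertexD[OF assms(1) is_hole_insert_path[OF d] _ H(1,2) _ H(3)])
    show "adj G (d k) (d (k - 1))" "adj G (d k) (d (Suc k))" "d (k - 1) \<noteq> d (Suc k)"
      using hole_path_adj[OF d] hole_path_eq[OF d] k by auto
  qed (use k in auto)
qed

text \<open>A shortest walk from \<open>a\<close> to \<open>b\<close> closes to a hole at
  \<open>u\<close>. Without \<open>Q\<close> it could not pass between the separated sides
  \<open>A\<close> and \<open>B\<close>.\<close>

lemma hole_detour:
  assumes u: "u \<in> verts G" "adj G u a" "adj G u b" and ab: "a \<in> A" "b \<in> B"
    and S: "A \<union> Q \<union> B \<subseteq> verts G" "u \<notin> A \<union> Q \<union> B" "reach G (A \<union> Q \<union> B) a b"
    and excl: "\<And>z. z \<in> A \<union> Q \<union> B \<Longrightarrow> adj G u z \<Longrightarrow> z = a \<or> z = b"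
    and sep: "\<And>x y. x \<in> A \<Longrightarrow> y \<in> B \<Longrightarrow> x \<noteq> y \<and> \<not> adj G x y"
  shows "Q \<inter> \<Union>(holes_at G u) \<noteq> {}"
proof -
  obtain H where H: "H \<in> holes G" "u \<in> H" "H \<subseteq> insert u (A \<union> Q \<union> B)" "reach G (H - {u}) a b"
    by (rule hole_through[of u G a b "A \<union> Q \<union> B"]) (use assms in \<open>auto\<close>)
  have "Q \<inter> H \<noteq> {}"
  proof
    assume "Q \<inter> H = {}"
    then have sub: "H - {u} \<subseteq> A \<union> B" using H(3) by blast
    have "b \<in> A"
      by (rule reach_invariant[OF H(4) ab(1)]) (use sub sep in blast)
    then show False using ab(2) sep by blast
  qed
  then show ?thesis using H by (auto simp: holes_at_def)
qed

lemma reach_via: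
  assumes "connected_in G Q" "touches G Q a'" "touches G Q b'" "a' \<in> A" "b' \<in> B"
    and "reach G A a a'" "reach G B b' b"
  shows "reach G (A \<union> Q \<union> B) a b"
proof -
  have "reach G (A \<union> Q \<union> B) a' b'"
    using connected_in_reach_touches[OF assms(1-3)]
    by (rule reach_mono) (use assms(4,5) in auto)
  moreover have "reach G (A \<union> Q \<union> B) a a'" "reach G (A \<union> Q \<union> B) b' b"
    by (rule reach_mono[OF assms(6)], blast, rule reach_mono[OF assms(7)], blast)
  ultimately show ?thesis by (meson reach_trans)
qed

subsection \<open>Chordalizing at a vertex creates no new holes\<close>

text \<open>In the application, \<open>Q\<close> is the part of a putative new hole at \<open>u\<close> that is not adjacent to
  \<open>u\<close> after chordalization.\<close>

locale detached =
  fixes G :: "'a graph" and u :: 'a and Q :: "'a set"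
  assumes NC: "NC_vertex G u" and u: "u \<in> verts G"
    and Q: "Q \<subseteq> verts G" "connected_in G Q" "u \<notin> Q"
    and Q_nonadj: "\<And>q. q \<in> Q \<Longrightarrow> \<not> adj G u q"
    and Q_holes: "Q \<inter> \<Union>(holes_at G u) = {}"
begin

text \<open>The hole given by \<open>hole_detour\<close> would meet \<open>Q\<close>, which no hole
  at \<open>u\<close> does. Here \<open>a'\<close> and \<open>b'\<close> are the points where the
  two sides attach to \<open>Q\<close>.\<close>

lemma no_detour:
  assumes "adj G u a" "adj G u b" "a \<in> A" "b \<in> B" "A \<union> B \<subseteq> verts G" "u \<notin> A \<union> B"
    and "\<And>z. z \<in> A \<union> B \<Longrightarrow> adj G u z \<Longrightarrow> z = a \<or> z = b"
    and "\<And>x y. x \<in> A \<Longrightarrow> y \<in> B \<Longrightarrow> x \<noteq> y \<and> \<not> adj G x y"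
    and "touches G Q a'" "touches G Q b'" "a' \<in> A" "b' \<in> B" "reach G A a a'" "reach G B b' b"
  shows False
proof -
  have "Q \<inter> \<Union>(holes_at G u) \<noteq> {}"
  proof (rule hole_detour[OF u assms(1-4)])
    show "reach G (A \<union> Q \<union> B) a b" by (rule reach_via[OF Q(2) assms(9-14)])
  qed (use assms Q Q_nonadj in auto)
  then show False using Q_holes by blast
qed

text \<open>With a gap between \<open>i\<close> and \<open>j\<close>, the two end arcs of the path
  are separated and \<open>Q\<close> provides a forbidden detour between them.\<close>

lemma path_attachments_consecutive:
  assumes d: "hole_path G u n d" and ij: "i < j" "j \<le> n"
    and t: "touches G Q (d i)" "touches G Q (d j)"
  shows "j = Suc i"
proof (rule ccontr)
  assume "j \<noteq> Suc i"
  show False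
  proof (rule no_detour[of "d 0" "d n" "d ` {..i}" "d ` {j..n}" "d i" "d j"])
    show "adj G u (d 0)" "adj G u (d n)" using hole_path_apex_adj[OF d] by auto
    show "d ` {..i} \<union> d ` {j..n} \<subseteq> verts G" "u \<notin> d ` {..i} \<union> d ` {j..n}"
      using d ij by (auto simp: hole_path_def)
    show "z = d 0 \<or> z = d n" if "z \<in> d ` {..i} \<union> d ` {j..n}" "adj G u z" for z
      using that hole_path_apex_adj[OF d] ij by auto
    show "x \<noteq> y \<and> \<not> adj G x y" if "x \<in> d ` {..i}" "y \<in> d ` {j..n}" for x y
      using that ij \<open>j \<noteq> Suc i\<close> hole_path_adj[OF d] hole_path_eq[OF d] by auto
    show "reach G (d ` {..i}) (d 0) (d i)" "reach G (d ` {j..n}) (d j) (d n)"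
      using ij by (auto intro!: hole_path_reach[OF d])
  qed (use ij t in auto)
qed

lemma path_attachments_adjacent:
  assumes d: "hole_path G u n d" and "i \<noteq> j" "i \<le> n" "j \<le> n"
    and "touches G Q (d i)" "touches G Q (d j)"
  shows "adj G (d i) (d j)"
  using path_attachments_consecutive[OF d, of i j] path_attachments_consecutive[OF d, of j i]
    assms hole_path_adj[OF d] by (metis linorder_neqE_nat)

text \<open>Otherwise the arc and the one-vertex side \<open>{x}\<close> are separated, and both
  attach to \<open>Q\<close>.\<close>

lemma neighbour_sees_arc:
  assumes d: "hole_path G u n d" and k: "k < n" "touches G Q (d k)"
    and x: "x \<in> verts G" "adj G u x" "touches G Q x" "x \<notin> d ` {..k}"
  shows "\<exists>i\<le>k. adj G x (d i)"
proof (rule ccontr)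
  assume no: "\<not> (\<exists>i\<le>k. adj G x (d i))"
  show False
  proof (rule no_detour[of "d 0" x "d ` {..k}" "{x}" "d k" x])
    show "adj G u (d 0)" using hole_path_apex_adj[OF d] by auto
    show "d ` {..k} \<union> {x} \<subseteq> verts G" "u \<notin> d ` {..k} \<union> {x}"
      using d k x by (auto simp: hole_path_def)
    show "z = d 0 \<or> z = x" if "z \<in> d ` {..k} \<union> {x}" "adj G u z" for z
      using that hole_path_apex_adj[OF d] k by auto
    show "y \<noteq> z \<and> \<not> adj G y z" if "y \<in> d ` {..k}" "z \<in> {x}" for y z
      using that x no by (auto simp: adj_commute[of G x])
    show "reach G (d ` {..k}) (d 0) (d k)"
      using k by (auto intro!: hole_path_reach[OF d])
  qed (use k x in auto)
qed

text \<open>If not, \<open>x\<close> sees both arcs ending in \<open>d k\<close>, hence vertices on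
  either side of \<open>d k\<close>, and \<open>{x}\<close> bypasses \<open>d k\<close>.\<close>

lemma neighbour_attachment_adjacent:
  assumes d: "hole_path G u n d" and k: "0 < k" "k < n" "touches G Q (d k)"
    and x: "x \<in> verts G" "adj G u x" "touches G Q x"
  shows "adj G x (d k)"
proof (rule ccontr)
  assume no: "\<not> adj G x (d k)"
  have k_nonadj: "\<not> adj G u (d k)" using hole_path_apex_adj[OF d] k by auto
  \<comment> \<open>On the path, \<open>x\<close> and \<open>d k\<close> would be two attachments
    and hence adjacent; they differ because only \<open>x\<close> is a neighbour of
    \<open>u\<close>.\<close>
  have x_off: "x \<notin> d ` {..n}"
    using path_attachments_adjacent[OF d, of _ k] no k x k_nonadj
    by (metis atMost_iff imageE less_imp_le_nat)
  obtain i where i: "i \<le> k" "adj G x (d i)"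
    using neighbour_sees_arc[OF d k(2,3) x] x_off k by fastforce
  have "(\<lambda>i. d (n - i)) ` {..n - k} \<subseteq> d ` {..n}" by auto
  then have "\<exists>i\<le>n - k. adj G x (d (n - i))"
    using neighbour_sees_arc[OF hole_path_reverse[OF d], of "n - k" x] k x x_off
    by (metis diff_diff_cancel diff_less less_imp_le_nat less_trans subsetD)
  then obtain j where j: "k \<le> j" "j \<le> n" "adj G x (d j)"
    using k by (metis diff_diff_cancel diff_le_mono2 diff_le_self less_imp_le_nat)
  have ij: "i \<noteq> k" "j \<noteq> k" using i j no by auto
  show False
    by (rule NC_vertex_no_bypass[OF NC d, of i k j "{x}"])
      (use i j ij k x x_off no u in \<open>auto simp: touches_def\<close>)
qed

text \<open>If neither \<open>d k\<close> nor its predecessor touches the arc \<open>e 0, \<dots>, e (l - 1)\<close>, then the bypass lemma at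
  \<open>d (k - 1)\<close> keeps the whole arc \<open>d 0, \<dots>, d k\<close> away from it, and the two arcs together with \<open>Q\<close>
  contain a hole at \<open>u\<close> meeting \<open>Q\<close>.\<close>

lemma arc_sees_side:
  assumes d: "hole_path G u n d" and k: "0 < k" "k < n" "touches G Q (d k)"
    and k_first: "\<And>i. i < k \<Longrightarrow> \<not> touches G Q (d i)"
    and e: "hole_path G u m e" and l: "0 < l" "l < m" "touches G Q (e l)"
    and far: "\<And>i. i \<le> k \<Longrightarrow> d i \<noteq> e l \<and> \<not> adj G (d i) (e l)"
    and off: "d k \<notin> e ` {..m}"
  shows "\<exists>i<l. touches G {d k, d (k - 1)} (e i)"
proof (rule ccontr)
  assume no: "\<not> (\<exists>i<l. touches G {d k, d (k - 1)} (e i))"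
  define X where "X = Q \<union> e ` {..l}"
  have nadj: "\<not> adj G (d k) (e i)" "\<not> adj G (d (k - 1)) (e i)" if "i \<le> l" for i
    using no far[of k] far[of "k - 1"] that by (cases "i = l"; force simp: touches_def)+
  moreover have "adj G (d k) (d (k - 1))" using hole_path_adj[OF d] k by auto
  ultimately have neq: "d (k - 1) \<notin> e ` {..l}"
    by (metis atMost_iff imageE)
  have X: "connected_in G X"
  proof -
    have "connected_in G (e ` {..l})"
      unfolding connected_in_def using l by (auto intro!: hole_path_reach[OF e])
    \<comment> \<open>Lying on a hole at \<open>u\<close>, the vertex \<open>e l\<close> is outside
      \<open>Q\<close>, so its touching \<open>Q\<close> is a genuine edge that joins the two
      connected pieces.\<close>
    moreover have "e l \<notin> Q"
      using Q_holes is_hole_insert_path[OF e] l unfolding holes_at_def by fastforce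
    then obtain q where "q \<in> Q" "adj G q (e l)" using l(3) by (auto simp: touches_def)
    ultimately show ?thesis unfolding X_def
      by (intro connected_in_Un[OF Q(2), of _ q "e l"]) auto
  qed
  have X': "X \<subseteq> verts G" "u \<notin> X"
    using Q e l by (auto simp: X_def hole_path_def)
  have "d (k - 1) \<notin> X"
    using k_first[of "k - 1"] k neq by (simp add: X_def touches_def)
  moreover have "\<not> adj G x (d (k - 1))" if "x \<in> X" for x
    using that k_first[of "k - 1"] k nadj by (auto simp: X_def touches_def adj_commute)
  ultimately have X_far: "x \<noteq> d (k - 1) \<and> \<not> adj G x (d (k - 1))" if "x \<in> X" for x
    using that by metis
  have untouched: "\<not> touches G X (d i)" if "i < k" for i
  proof (cases "i = k - 1")
    case True
    then show ?thesis using X_far by (auto simp: touches_def)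
  next
    case False
    then have "i < k - 1" using that by simp
    moreover have "touches G X (d k)" using k(3) by (auto simp: touches_def X_def)
    ultimately show ?thesis
      using NC_vertex_no_bypass[OF NC d, of i "k - 1" k X] X X' X_far k by auto
  qed
  show False
  proof (rule no_detour[of "d 0" "e 0" "d ` {..k}" "e ` {..l}" "d k" "e l"])
    show "adj G u (d 0)" "adj G u (e 0)"
      using hole_path_apex_adj[OF d] hole_path_apex_adj[OF e] by auto
    show "d ` {..k} \<union> e ` {..l} \<subseteq> verts G" "u \<notin> d ` {..k} \<union> e ` {..l}"
      using d k e l by (auto simp: hole_path_def)
    show "z = d 0 \<or> z = e 0" if "z \<in> d ` {..k} \<union> e ` {..l}" "adj G u z" for z
      using that hole_path_apex_adj[OF d] hole_path_apex_adj[OF e] k l by auto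
    show "x \<noteq> y \<and> \<not> adj G x y" if xy: "x \<in> d ` {..k}" "y \<in> e ` {..l}" for x y
    proof -
      obtain i j where ij: "i \<le> k" "x = d i" "j \<le> l" "y = e j" using xy by auto
      show ?thesis
      proof (cases "i = k")
        case True
        then show ?thesis using ij off l nadj by auto
      next
        case False
        then show ?thesis using ij untouched[of i] adj_commute[of G x y]
          by (auto simp: touches_def X_def)
      qed
    qed
    show "reach G (d ` {..k}) (d 0) (d k)" "reach G (e ` {..l}) (e l) (e 0)"
      using k l by (auto intro!: hole_path_reach[OF d] hole_path_reach[OF e])
  qed (use k l in auto)
qed

text \<open>Applied to \<open>e\<close> and to its reversal, \<open>arc_sees_side\<close> makes the
  connected pair \<open>d k\<close>, \<open>d (k - 1)\<close> touch the path \<open>e\<close> on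
  both sides of \<open>e l\<close>. The pair is far from \<open>e l\<close>, so it bypasses
  \<open>e l\<close>.\<close>

lemma first_attachment_contradiction:
  assumes d: "hole_path G u n d" and k: "0 < k" "k < n" "touches G Q (d k)"
    and k_first: "\<And>i. i < k \<Longrightarrow> \<not> touches G Q (d i)"
    and e: "hole_path G u m e" and l: "0 < l" "l < m" "touches G Q (e l)"
    and far: "\<And>i. i \<le> k \<Longrightarrow> d i \<noteq> e l \<and> \<not> adj G (d i) (e l)"
    and off: "d k \<notin> e ` {..m}"
  shows False
proof -
  let ?X = "{d k, d (k - 1)}"
  obtain i where i: "i < l" "touches G ?X (e i)"
    using arc_sees_side[OF assms(1-5) e l] far off by blast
  have "\<exists>i<m - l. touches G ?X (e (m - i))"
    by (rule arc_sees_side[OF assms(1-5) hole_path_reverse[OF e]]) (use l far off in auto)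
  then obtain j where j: "j < m - l" "touches G ?X (e (m - j))" by blast
  have "connected_in G ({d k} \<union> {d (k - 1)})"
    by (rule connected_in_Un[of _ _ _ "d k" "d (k - 1)"]) (use hole_path_adj[OF d] k in auto)
  then have conn: "connected_in G ?X" by (simp add: insert_commute)
  have sub: "?X \<subseteq> d ` {..n}" using k by auto
  show False
    by (rule NC_vertex_no_bypass[OF NC e, of i l "m - j" ?X])
      (use i j conn l far[of k] far[of "k - 1"] sub d in \<open>auto simp: hole_path_def\<close>)
qed

text \<open>If not, either \<open>e l\<close> misses one whole arc ending in \<open>d k\<close>, and
  the first attachment on that arc gives a contradiction, or \<open>e l\<close> has neighbours on
  both sides of \<open>d k\<close> and bypasses it.\<close>

lemma inner_attachments_adjacent:
  assumes d: "hole_path G u n d" and k: "0 < k" "k < n" "touches G Q (d k)"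
    and e: "hole_path G u m e" and l: "0 < l" "l < m" "touches G Q (e l)"
    and neq: "d k \<noteq> e l"
  shows "adj G (d k) (e l)"
proof (rule ccontr)
  assume no: "\<not> adj G (d k) (e l)"
  have x_off: "e l \<notin> d ` {..n}"
    using path_attachments_adjacent[OF d, of k] no k l neq
    by (metis atMost_iff imageE less_imp_le_nat)
  \<comment> \<open>Stated for arbitrary \<open>d\<close> and \<open>k\<close> so that it also
    applies to the reversed path.\<close>
  have False if d: "hole_path G u n d" and k: "k < n" "touches G Q (d k)"
    and free: "\<forall>i\<le>k. d i \<noteq> e l \<and> \<not> adj G (d i) (e l)" for d k
  proof -
    define k' where "k' = (LEAST i. touches G Q (d i))"
    have k': "touches G Q (d k')" "k' \<le> k" "\<And>i. i < k' \<Longrightarrow> \<not> touches G Q (d i)"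
      unfolding k'_def using k by (auto intro: LeastI Least_le dest: not_less_Least)
    \<comment> \<open>If the first attachment is \<open>d 0\<close>, it is a neighbour of
      \<open>u\<close>, and the mixed case already makes it adjacent to \<open>e l\<close>.\<close>
    have "adj G (d 0) (e l)" if "k' = 0"
      by (rule neighbour_attachment_adjacent[OF e l])
        (use k' that hole_path_verts[OF d] hole_path_apex_adj[OF d] in auto)
    then have "0 < k'" using free by auto
    moreover have "d k' \<notin> e ` {..m}"
      using path_attachments_adjacent[OF e, of _ l] k' l free
      by (metis atMost_iff imageE less_imp_le_nat)
    ultimately show False
      using first_attachment_contradiction[OF d _ _ _ _ e l, of k'] k' k free by auto
  qed
  note contra = this
  have d_neq: "d i \<noteq> e l" if "i \<le> n" for i
    using x_off that by force
  obtain i where i: "i \<le> k" "adj G (d i) (e l)"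
    using contra[OF d k(2,3)] d_neq k by (meson less_imp_le_nat order_trans)
  have "\<exists>j\<le>n - k. adj G (d (n - j)) (e l)"
    using contra[OF hole_path_reverse[OF d], of "n - k"] d_neq k by auto
  then obtain j where j: "k \<le> j" "j \<le> n" "adj G (d j) (e l)"
    using k by (metis diff_diff_cancel diff_le_mono2 diff_le_self less_imp_le_nat)
  have ij: "i \<noteq> k" "j \<noteq> k" using i j no by auto
  show False
    by (rule NC_vertex_no_bypass[OF NC d, of i k j "{e l}"])
      (use i j ij k l x_off no hole_path_verts[OF e] hole_path_neq_apex[OF e, of l] in
        \<open>auto simp: touches_def adj_commute[of G "e l"]\<close>)
qed

text \<open>The candidates \<open>w\<close> and \<open>x\<close> are neighbours of \<open>u\<close>
  or inner vertices of holes at \<open>u\<close>; each of the cases is settled by a preceding lemma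
  or, for two neighbours, by a detour between singletons.\<close>

lemma attachments_adjacent:
  assumes w: "w \<in> verts G" "w \<noteq> u" "adj G u w \<or> w \<in> \<Union>(holes_at G u)" "touches G Q w"
    and x: "x \<in> verts G" "x \<noteq> u" "adj G u x \<or> x \<in> \<Union>(holes_at G u)" "touches G Q x"
    and "w \<noteq> x"
  shows "adj G w x"
proof -
  have inner: "\<exists>n d k. hole_path G u n d \<and> 0 < k \<and> k < n \<and> y = d k"
    if y: "y \<noteq> u" "y \<in> \<Union>(holes_at G u)" "\<not> adj G u y" for y
  proof -
    obtain H where H: "H \<in> holes_at G u" "y \<in> H" using y by blast
    obtain n d where d: "hole_path G u n d" "H = insert u (d ` {..n})"
      using hole_path_exists[OF H(1)] .
    then obtain k where k: "k \<le> n" "y = d k" using H y by auto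
    then have "0 < k" "k < n" using hole_path_apex_adj[OF d(1)] y by (auto simp: le_less)
    then show ?thesis using d k by blast
  qed
  show ?thesis
  proof (cases "adj G u w"; cases "adj G u x")
    assume "adj G u w" "adj G u x"
    show ?thesis
    proof (rule ccontr)
      assume "\<not> adj G w x"
      show False
        by (rule no_detour[of w x "{w}" "{x}" w x])
          (use assms \<open>adj G u w\<close> \<open>adj G u x\<close> \<open>\<not> adj G w x\<close> in auto)
    qed
  next
    assume "adj G u w" "\<not> adj G u x"
    then show ?thesis using inner[of x] neighbour_attachment_adjacent w x by blast
  next
    assume "\<not> adj G u w" "adj G u x"
    then show ?thesis
      using inner[of w] neighbour_attachment_adjacent w x adj_commute[of G w x] by blast
  next
    assume "\<not> adj G u w" "\<not> adj G u x"
    then show ?thesis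
      using inner[of w] inner[of x] inner_attachments_adjacent w x \<open>w \<noteq> x\<close> by blast
  qed
qed

end

section \<open>Holes and the NC property under local chordalization\<close>

lemma verts_local_chordalize [simp]: "verts (local_chordalize G u) = verts G"
  by (simp add: local_chordalize_def verts_def)

lemma edges_local_chordalize:
  "edges (local_chordalize G u) = edges G \<union> {{u, w} | w. w \<noteq> u \<and> w \<in> \<Union>(holes_at G u)}"
  by (simp add: local_chordalize_def edges_def)

lemma adj_local_chordalize:
  "adj (local_chordalize G u) a b \<longleftrightarrow> adj G a b \<or>
     a \<noteq> b \<and> (a = u \<and> b \<in> \<Union>(holes_at G u) \<or> b = u \<and> a \<in> \<Union>(holes_at G u))"
  unfolding adj_def edges_local_chordalize by (auto simp: doubleton_eq_iff)

lemma adj_local_chordalize_off [simp]: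
  "a \<noteq> u \<Longrightarrow> b \<noteq> u \<Longrightarrow> adj (local_chordalize G u) a b \<longleftrightarrow> adj G a b"
  by (auto simp: adj_local_chordalize)

lemma holes_local_chordalize:
  assumes NC: "NC_vertex G u" and H: "H \<in> holes (local_chordalize G u)"
  shows "H \<in> holes G" "u \<notin> H"
proof -
  let ?G' = "local_chordalize G u"
  show u: "u \<notin> H"
  proof
    assume "u \<in> H"
    then have "H \<in> holes_at ?G' u" using H by (simp add: holes_at_def)
    then obtain n d where d: "hole_path ?G' u n d" by (rule hole_path_exists)
    have n: "2 \<le> n" using d by (simp add: hole_path_def)
    have adj: "adj G (d i) (d j) \<longleftrightarrow> j = Suc i \<or> i = Suc j" if "i \<le> n" "j \<le> n" for i j
      using hole_path_adj[OF d that] hole_path_neq_apex[OF d] that by simp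
    have apex: "adj G u (d i) \<or> d i \<in> \<Union>(holes_at G u) \<longleftrightarrow> i = 0 \<or> i = n" if "i \<le> n" for i
      using hole_path_apex_adj[OF d that] hole_path_neq_apex[OF d that]
      by (auto simp: adj_local_chordalize)
    \<comment> \<open>The inner vertices are not joined to \<open>u\<close> after chordalization, so
      they are neither old neighbours of \<open>u\<close> nor on old holes at \<open>u\<close>:
      \<open>Q\<close> is detached. The path ends attach to \<open>Q\<close>, hence would be
      adjacent, a chord of the hole.\<close>
    define Q where "Q = d ` {0<..<n}"
    have steps: "reach G Q (d i) (d j)" if "0 < i" "i \<le> j" "j < n" for i j
      using that(2,1,3)
    proof (induction j rule: dec_induct)
      case (step j)
      moreover have "reach G Q (d j) (d (Suc j))"
        using step by (intro reach_step) (auto simp: Q_def adj)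
      ultimately show ?case by (meson Suc_lessD reach_trans)
    qed simp
    have "connected_in G Q"
      unfolding connected_in_def
    proof (intro ballI)
      fix x y assume "x \<in> Q" "y \<in> Q"
      then obtain i j where "x = d i" "y = d j" "0 < i" "i < n" "0 < j" "j < n"
        unfolding Q_def by auto
      then show "reach G Q x y" using steps by (metis linear reach_sym)
    qed
    moreover have "Q \<subseteq> verts G" "u \<notin> Q" "u \<in> verts G"
      using d by (auto simp: Q_def hole_path_def)
    moreover have "\<not> (adj G u q \<or> q \<in> \<Union>(holes_at G u))" if "q \<in> Q" for q
      using that apex unfolding Q_def
      by (metis greaterThanLessThan_iff imageE less_imp_le_nat less_irrefl)
    ultimately interpret detached G u Q
      using NC by unfold_locales auto
    have "adj G (d 0) (d n)"
    proof (rule attachments_adjacent)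
      have "d 1 \<in> Q" "adj G (d 1) (d 0)" using n adj by (auto simp: Q_def)
      then show "touches G Q (d 0)" by (auto simp: touches_def)
      have "d (n - 1) \<in> Q" "adj G (d (n - 1)) (d n)" using n adj by (auto simp: Q_def)
      then show "touches G Q (d n)" by (auto simp: touches_def)
      show "d 0 \<noteq> d n" using hole_path_eq[OF d, of 0 n] n by auto
    qed (use hole_path_verts[OF d] hole_path_neq_apex[OF d] apex in auto)
    then show False using adj n by auto
  qed
  from H obtain vs where vs: "set vs = H" "distinct vs" "length vs \<ge> 4" "H \<subseteq> verts G"
    and adj: "\<forall>i<length vs. \<forall>j<length vs. adj ?G' (vs ! i) (vs ! j) \<longleftrightarrow>
        (j = Suc i mod length vs \<or> i = Suc j mod length vs)"
    unfolding holes_def is_hole_def by auto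
  \<comment> \<open>Away from \<open>u\<close> the two graphs have the same adjacency.\<close>
  have "vs ! i \<noteq> u" if "i < length vs" for i using u vs(1) that nth_mem by blast
  then show "H \<in> holes G"
    using vs adj unfolding holes_def is_hole_def by auto
qed

lemma holes_at_local_chordalize:
  "NC_vertex G u \<Longrightarrow> holes_at (local_chordalize G u) v \<subseteq> holes_at G v"
  using holes_local_chordalize(1)[of G u] by (auto simp: holes_at_def)

text \<open>Every surviving hole is an old one avoiding \<open>u\<close>, so it keeps its edge set
  and no new conflict can arise.\<close>

lemma NC_set_local_chordalize:
  assumes "NC_set G C" "u \<in> C"
  shows "NC_set (local_chordalize G u) C"
proof -
  let ?G' = "local_chordalize G u"
  have NC: "NC_vertex G v" if "v \<in> C" for v using assms that by (simp add: NC_set_def)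
  note hole = holes_local_chordalize[OF NC[OF assms(2)]]
  have "hole_edges ?G' H = hole_edges G H" if "H \<in> holes ?G'" for H
    using hole(2)[OF that] by (auto simp: hole_edges_def edges_local_chordalize)
  then have "NC_vertex ?G' v" if "v \<in> C" for v
    using NC[OF that] hole(1) unfolding NC_vertex_def holes_at_def
    by (metis (no_types, lifting) Diff_iff mem_Collect_eq)
  then show ?thesis
    using assms hole by (auto simp: NC_set_def)
qed

subsection \<open>Cliques of the chordalized graph\<close>

text \<open>Since holes only disappear along the way, every added edge is accounted for by a hole of
  the initial graph.\<close>

lemma foldl_local_chordalize:
  assumes "NC_set G C" "set xs \<subseteq> C"
  shows "verts (foldl local_chordalize G xs) = verts G \<and>
    edges G \<subseteq> edges (foldl local_chordalize G xs) \<and>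
    edges (foldl local_chordalize G xs) \<subseteq>
      edges G \<union> {{v, w} | v w. v \<in> C \<and> w \<noteq> v \<and> w \<in> \<Union>(holes_at G v)}"
  using assms
proof (induction xs arbitrary: G)
  case (Cons u xs)
  let ?G = "local_chordalize G u"
  have NC: "NC_vertex G u" and u: "u \<in> C" using Cons.prems by (auto simp: NC_set_def)
  have IH: "verts (foldl local_chordalize ?G xs) = verts ?G"
    "edges ?G \<subseteq> edges (foldl local_chordalize ?G xs)"
    "edges (foldl local_chordalize ?G xs) \<subseteq>
      edges ?G \<union> {{v, w} | v w. v \<in> C \<and> w \<noteq> v \<and> w \<in> \<Union>(holes_at ?G v)}"
    using Cons.IH[of ?G] NC_set_local_chordalize[OF Cons.prems(1) u] Cons.prems(2) by auto
  have fill: "{{v, w} | v w. v \<in> C \<and> w \<noteq> v \<and> w \<in> \<Union>(holes_at ?G v)} \<subseteq>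
      {{v, w} | v w. v \<in> C \<and> w \<noteq> v \<and> w \<in> \<Union>(holes_at G v)}"
    using holes_at_local_chordalize[OF NC] by blast
  have "edges ?G \<subseteq> edges G \<union> {{v, w} | v w. v \<in> C \<and> w \<noteq> v \<and> w \<in> \<Union>(holes_at G v)}"
    using u unfolding edges_local_chordalize by blast
  from Un_least[OF this subset_trans[OF fill Un_upper2]]
  have "edges (foldl local_chordalize ?G xs) \<subseteq>
      edges G \<union> {{v, w} | v w. v \<in> C \<and> w \<noteq> v \<and> w \<in> \<Union>(holes_at G v)}"
    by (rule subset_trans[OF IH(3)])
  moreover have "edges G \<subseteq> edges (foldl local_chordalize ?G xs)"
    by (rule subset_trans[OF _ IH(2)]) (simp add: edges_local_chordalize)
  ultimately show ?case using IH(1) by simp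
qed auto

lemma hat_bounds:
  assumes "NC_set G C" "finite C"
  shows "verts (hat G C) = verts G" "edges G \<subseteq> edges (hat G C)"
    "edges (hat G C) \<subseteq> edges G \<union> {{v, w} | v w. v \<in> C \<and> w \<noteq> v \<and> w \<in> \<Union>(holes_at G v)}"
proof -
  define xs where "xs = (SOME xs. set xs = C \<and> distinct xs)"
  have "set xs = C \<and> distinct xs"
    unfolding xs_def by (rule someI_ex) (use finite_distinct_list[OF assms(2)] in auto)
  then show "verts (hat G C) = verts G" "edges G \<subseteq> edges (hat G C)"
    "edges (hat G C) \<subseteq> edges G \<union> {{v, w} | v w. v \<in> C \<and> w \<noteq> v \<and> w \<in> \<Union>(holes_at G v)}"
    using foldl_local_chordalize[OF assms(1), of xs] unfolding hat_def xs_def[symmetric] by auto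
qed

lemma NC_set_hole_unique:
  assumes "NC_set G C" "H \<in> holes G" "u \<in> H" "v \<in> H" "u \<in> C" "v \<in> C"
  shows "u = v"
proof -
  have "finite H" using assms(2) by (auto simp: holes_def is_hole_def)
  moreover have "card (H \<inter> C) \<le> Suc 0" using assms by (simp add: NC_set_def)
  ultimately show ?thesis
    using assms card_le_Suc0_iff_eq[of "H \<inter> C"] by auto
qed

text \<open>Oriented from the apex \<open>u\<close>. Excluding old neighbours makes \<open>w\<close>
  an inner vertex of the path of a hole at \<open>u\<close>.\<close>

definition fill_edge :: "'a graph \<Rightarrow> 'a \<Rightarrow> 'a \<Rightarrow> bool" where
  "fill_edge G u w \<longleftrightarrow> w \<noteq> u \<and> \<not> adj G u w \<and> w \<in> \<Union>(holes_at G u)"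

lemma fill_edge_hole_path:
  assumes "fill_edge G u w"
  obtains n d k where "hole_path G u n d" "0 < k" "k < n" "w = d k"
proof -
  obtain H where H: "H \<in> holes_at G u" "w \<in> H" using assms by (auto simp: fill_edge_def)
  obtain n d where d: "hole_path G u n d" "H = insert u (d ` {..n})"
    using hole_path_exists[OF H(1)] .
  then obtain k where k: "k \<le> n" "w = d k" using H assms by (auto simp: fill_edge_def)
  then have "0 < k" "k < n"
    using hole_path_apex_adj[OF d(1), of k] assms by (auto simp: fill_edge_def le_less)
  then show thesis using that d k by blast
qed

text \<open>As another vertex of \<open>C\<close>, \<open>v\<close> is off the hole at
  \<open>u\<close>. Neighbours of \<open>v\<close> on both sides of \<open>w\<close> would let
  \<open>{v}\<close> bypass \<open>w\<close>, and the resulting hole through \<open>v\<close> would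
  violate NC at \<open>v\<close>. Reversal makes the free side the initial arc.\<close>

lemma fill_edge_free_side:
  assumes NC: "NC_set G C" "u \<in> C" "v \<in> C" "u \<noteq> v" "v \<in> verts G"
    and w: "fill_edge G u w" "\<not> adj G v w" "v \<noteq> w"
  obtains n d k where "hole_path G u n d" "0 < k" "k < n" "w = d k"
    "\<forall>i\<le>k. \<not> adj G v (d i)"
proof -
  obtain n d k where d: "hole_path G u n d" and k: "0 < k" "k < n" "w = d k"
    using w(1) by (rule fill_edge_hole_path)
  have off: "v \<notin> insert u (d ` {..n})"
    using NC_set_hole_unique[OF NC(1) is_hole_insert_path[OF d], of u v] NC by auto
  have "\<not> (\<exists>i j. i < k \<and> k < j \<and> j \<le> n \<and> adj G v (d i) \<and> adj G v (d j))"
  proof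
    assume "\<exists>i j. i < k \<and> k < j \<and> j \<le> n \<and> adj G v (d i) \<and> adj G v (d j)"
    then obtain i j where ij: "i < k" "k < j" "j \<le> n" "adj G v (d i)" "adj G v (d j)" by blast
    obtain H where H: "H \<in> holes G" "d (k - 1) \<in> H" "d k \<in> H" "d (Suc k) \<in> H" "H \<inter> {v} \<noteq> {}"
      by (rule hole_path_bypass[OF d ij(1-3), of "{v}"])
        (use NC w k ij in \<open>auto simp: touches_def\<close>)
    have "NC_vertex G v" using NC by (simp add: NC_set_def)
    then show False
    proof (rule NC_vertexD[OF _ H(1) _ is_hole_insert_path[OF d] off])
      show "adj G (d k) (d (k - 1))" "adj G (d k) (d (Suc k))" "d (k - 1) \<noteq> d (Suc k)"
        using hole_path_adj[OF d] hole_path_eq[OF d] k by auto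
    qed (use H k in auto)
  qed
  then consider "\<forall>i<k. \<not> adj G v (d i)" | "\<forall>j. k < j \<and> j \<le> n \<longrightarrow> \<not> adj G v (d j)"
    by blast
  then show thesis
  proof cases
    case 1
    then show thesis using that[OF d k] w(2) k(3) by (auto simp: le_less)
  next
    case 2
    have "\<not> adj G v (d (n - i))" if "i \<le> n - k" for i
      using 2 w(2) k that by (cases "n - i = k") auto
    then show thesis
      using that[OF hole_path_reverse[OF d], of "n - k"] k by auto
  qed
qed

lemma fill_edges_no_common_end:
  assumes NC: "NC_set G C" "u \<in> C" "v \<in> C" "adj G u v" "C \<subseteq> verts G"
    and w: "fill_edge G u w" "fill_edge G v w"
  shows False
proof -
  have uv: "u \<noteq> v" using NC(4) by auto
  obtain n d k where d: "hole_path G u n d" and k: "0 < k" "k < n" "w = d k"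
    and dv: "\<forall>i\<le>k. \<not> adj G v (d i)"
    by (rule fill_edge_free_side[OF NC(1-3) uv _ w(1)]) (use NC w in \<open>auto simp: fill_edge_def\<close>)
  obtain m e l where e: "hole_path G v m e" and l: "0 < l" "l < m" "w = e l"
    and eu: "\<forall>i\<le>l. \<not> adj G u (e i)"
    by (rule fill_edge_free_side[OF NC(1,3,2) uv[symmetric] _ w(2)])
      (use NC w in \<open>auto simp: fill_edge_def\<close>)
  \<comment> \<open>From \<open>v\<close> along the free side of the hole at \<open>v\<close> to
    \<open>w\<close>, then back along the free side of the hole at \<open>u\<close> to
    \<open>d 0\<close>; closing at \<open>u\<close> gives a hole through both \<open>u\<close> and
    \<open>v\<close>.\<close>
  define S where "S = insert v (d ` {..k} \<union> e ` {..l})"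
  have "reach G S v (e 0)"
    using hole_path_apex_adj[OF e] by (intro reach_step) (auto simp: S_def)
  moreover have "reach G S (e 0) (e l)"
    using l by (intro hole_path_reach[OF e]) (auto simp: S_def)
  moreover have "reach G S (d k) (d 0)"
    using k by (intro hole_path_reach[OF d]) (auto simp: S_def)
  ultimately have reach: "reach G S v (d 0)"
    using k(3) l(3) by (metis reach_trans)
  have u_off: "u \<notin> e ` {..m}"
    using NC_set_hole_unique[OF NC(1) is_hole_insert_path[OF e], of u v] NC uv by auto
  have v_off: "v \<notin> d ` {..n}"
    using NC_set_hole_unique[OF NC(1) is_hole_insert_path[OF d], of u v] NC uv by auto
  obtain H where "H \<in> holes G" "u \<in> H" "v \<in> H"
  proof (rule hole_through[of u G v "d 0" S])
    show "u \<in> verts G" "adj G u v" using NC by auto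
    show "adj G u (d 0)" using hole_path_apex_adj[OF d] by auto
    show "v \<noteq> d 0" using v_off by auto
    show "\<not> adj G v (d 0)" using dv by auto
    show "S \<subseteq> verts G" using NC d e k l by (auto simp: S_def hole_path_def)
    show "u \<notin> S" using uv u_off d k l by (auto simp: S_def hole_path_def)
    show "z = v \<or> z = d 0" if "z \<in> S" "adj G u z" for z
      using that eu hole_path_apex_adj[OF d] k by (auto simp: S_def)
  qed (use reach in \<open>auto simp: S_def\<close>)
  then show False using NC_set_hole_unique[OF NC(1)] NC uv by blast
qed

lemma clique_fill_edges_one_apex:
  assumes NC: "NC_set G C" "C \<subseteq> verts G"
    and G': "\<And>a b. adj G' a b \<Longrightarrow> adj G a b \<or> a \<in> C \<and> fill_edge G a b \<or> b \<in> C \<and> fill_edge G b a"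
    and K: "clique G' K"
  shows "\<exists>U \<subseteq> K \<inter> C. card U \<le> 1 \<and> clique G (K - U)"
proof -
  define U where "U = {u \<in> K \<inter> C. \<exists>w\<in>K. fill_edge G u w}"
  \<comment> \<open>A fill edge within \<open>C\<close> would put two vertices of \<open>C\<close>
    on one hole.\<close>
  have off: "w \<notin> C" if "u \<in> C" "fill_edge G u w" for u w
    using that NC_set_hole_unique[OF NC(1), of _ u w] by (auto simp: fill_edge_def holes_at_def)
  have KC: "adj G a b \<or> a \<in> C \<and> fill_edge G a b \<or> b \<in> C \<and> fill_edge G b a"
    if "a \<in> K" "b \<in> K" "a \<noteq> b" for a b
    using G' K that by (auto simp: clique_def)
  have uniq: "u = v" if U: "u \<in> U" "v \<in> U" for u v
  proof (rule ccontr)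
    assume "u \<noteq> v"
    obtain w where w: "w \<in> K" "fill_edge G u w" using U by (auto simp: U_def)
    obtain x where x: "x \<in> K" "fill_edge G v x" using U by (auto simp: U_def)
    have uv: "u \<in> K" "v \<in> K" "u \<in> C" "v \<in> C" using U by (auto simp: U_def)
    have wx: "w \<notin> C" "x \<notin> C" using off uv w x by auto
    have adj_uv: "adj G u v" using KC[of u v] off uv \<open>u \<noteq> v\<close> by auto
    have nadj: "\<not> adj G u w" "\<not> adj G v x" using w x by (auto simp: fill_edge_def)
    have vw: "adj G v w"
      using KC[of v w] fill_edges_no_common_end[OF NC(1) uv(3,4) adj_uv NC(2) w(2)] uv w wx by auto
    have ux: "adj G u x"
      using KC[of u x] fill_edges_no_common_end[OF NC(1) uv(3,4) adj_uv NC(2) _ x(2)] uv x wx by auto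
    have "w \<noteq> x" using vw nadj by auto
    then have adj_wx: "adj G w x" using KC[of w x] w x wx by auto
    have verts: "u \<in> verts G" "v \<in> verts G" "w \<in> verts G" "x \<in> verts G"
      using uv NC w x by (auto simp: fill_edge_def holes_at_def holes_def is_hole_def)
    \<comment> \<open>The vertices \<open>u\<close>, \<open>v\<close>, \<open>w\<close>,
      \<open>x\<close> form a 4-cycle whose diagonals \<open>uw\<close> and \<open>vx\<close> are
      not edges of \<open>G\<close>.\<close>
    let ?S = "{v, w, x}"
    have reach: "reach G ?S v x"
      using vw adj_wx by (meson insertCI reach_step reach_trans)
    obtain H where "H \<in> holes G" "u \<in> H" "v \<in> H"
      by (rule hole_through[of u G v x ?S])
        (use verts adj_uv ux nadj wx uv reach \<open>u \<noteq> v\<close> in \<open>auto simp: adj_commute\<close>)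
    then show False using NC_set_hole_unique[OF NC(1)] uv \<open>u \<noteq> v\<close> by blast
  qed
  have "card U \<le> 1"
  proof (cases "U = {}")
    case False
    then obtain u where "U = {u}" using uniq by blast
    then show ?thesis by simp
  qed simp
  moreover have "adj G a b" if "a \<in> K - U" "b \<in> K - U" "a \<noteq> b" for a b
    using KC[of a b] that by (auto simp: U_def)
  then have "clique G (K - U)" by (simp add: clique_def)
  moreover have "U \<subseteq> K \<inter> C" by (auto simp: U_def)
  ultimately show ?thesis by blast
qed

lemma clique_hat:
  assumes NC: "NC_set G C" "C \<subseteq> verts G" "finite C" and K: "clique (hat G C) K"
  shows "\<exists>U \<subseteq> K \<inter> C. card U \<le> 1 \<and> clique G (K - U)"
proof (rule clique_fill_edges_one_apex[OF NC(1,2) _ K])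
  fix a b
  assume "adj (hat G C) a b"
  then have "a \<noteq> b" "{a, b} \<in> edges (hat G C)" by (auto simp: adj_def)
  then have "{a, b} \<in> edges G \<or>
      (\<exists>v w. {a, b} = {v, w} \<and> v \<in> C \<and> w \<noteq> v \<and> w \<in> \<Union>(holes_at G v))"
    using subsetD[OF hat_bounds(3)[OF NC(1,3)], of "{a, b}"] by simp
  then consider "{a, b} \<in> edges G"
    | v w where "{a, b} = {v, w}" "v \<in> C" "w \<noteq> v" "w \<in> \<Union>(holes_at G v)"
    by metis
  then show "adj G a b \<or> a \<in> C \<and> fill_edge G a b \<or> b \<in> C \<and> fill_edge G b a"
  proof cases
    case 1
    then show ?thesis using \<open>a \<noteq> b\<close> by (simp add: adj_def)
  next
    case 2
    then have "a = v \<and> b = w \<or> a = w \<and> b = v" by (auto simp: doubleton_eq_iff)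
    then show ?thesis using 2 adj_commute[of G a b] by (auto simp: fill_edge_def)
  qed
qed

subsection \<open>The chordalization chain\<close>

lemma verts_del_verts [simp]: "verts (del_verts G S) = verts G - S"
  by (simp add: del_verts_def verts_def)

lemma edges_del_verts [simp]: "edges (del_verts G S) = {e \<in> edges G. e \<inter> S = {}}"
  by (simp add: del_verts_def edges_def)

declare chain_G.simps [simp del] chain_Gstar.simps [simp del]

text \<open>With zero-based positions, these are exactly the parts not yet present in
  \<open>chain_Gstar G Cs i\<close>.\<close>

definition later_parts :: "'a set list \<Rightarrow> nat \<Rightarrow> 'a set" where
  "later_parts Cs i = (\<Union>j\<in>{i..<length Cs}. Cs ! j)"

lemma later_parts_0: "later_parts Cs 0 = \<Union>(set Cs)"
proof -
  have "set Cs = (!) Cs ` {0..<length Cs}" by (auto simp: set_conv_nth)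
  then show ?thesis by (simp add: later_parts_def)
qed

lemma later_parts_Suc:
  assumes "i < length Cs"
  shows "later_parts Cs i = Cs ! i \<union> later_parts Cs (Suc i)"
proof -
  have "{i..<length Cs} = insert i {Suc i..<length Cs}" using assms by auto
  then show ?thesis by (simp add: later_parts_def)
qed

lemma chain_G_Suc:
  "verts (chain_G G Cs (Suc i)) = verts (chain_Gstar G Cs i) \<union> Cs ! i"
  "edges (chain_G G Cs (Suc i)) =
     edges (chain_Gstar G Cs i) \<union> {e \<in> edges G. e \<inter> later_parts Cs (Suc i) = {}}"
proof -
  have "{Cs ! j | j. i < j \<and> j < length Cs} = (!) Cs ` {Suc i..<length Cs}"
    by (auto simp: Suc_le_eq)
  then have "\<Union>{Cs ! j | j. i < j \<and> j < length Cs} = later_parts Cs (Suc i)"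
    by (simp add: later_parts_def)
  then show "verts (chain_G G Cs (Suc i)) = verts (chain_Gstar G Cs i) \<union> Cs ! i"
    "edges (chain_G G Cs (Suc i)) =
      edges (chain_Gstar G Cs i) \<union> {e \<in> edges G. e \<inter> later_parts Cs (Suc i) = {}}"
    by (simp_all add: chain_G.simps verts_def edges_def del_verts_def)
qed

lemma partition_part:
  assumes "simple_graph G" "local_chordalization_partition G C Cs" "i < length Cs"
  shows "Cs ! i \<subseteq> verts G" "finite (Cs ! i)" "NC_set (chain_G G Cs (Suc i)) (Cs ! i)"
    "\<And>j. j < length Cs \<Longrightarrow> j \<noteq> i \<Longrightarrow> Cs ! i \<inter> Cs ! j = {}"
proof -
  have C: "C \<subseteq> verts G" "\<Union>(set Cs) = C"
    using assms(2)
    by (auto simp: local_chordalization_partition_def hole_cover_def ordered_partition_def)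
  then show sub: "Cs ! i \<subseteq> verts G" using assms(3) by (metis Sup_upper nth_mem order_trans)
  then show "finite (Cs ! i)"
    using assms(1) by (auto simp: simple_graph_def intro: finite_subset)
  show "NC_set (chain_G G Cs (Suc i)) (Cs ! i)"
    using assms(2,3) by (simp add: local_chordalization_partition_def)
  show "Cs ! i \<inter> Cs ! j = {}" if "j < length Cs" "j \<noteq> i" for j
    using assms(2,3) that
    unfolding local_chordalization_partition_def ordered_partition_def by metis
qed

text \<open>Makes the step from \<open>chain_Gstar G Cs i\<close> to
  \<open>chain_G G Cs (Suc i)\<close> transparent: only edges of \<open>G\<close> meeting
  \<open>Cs ! i\<close> are new.\<close>

lemma chain_Gstar_invariant:
  assumes G: "simple_graph G" and P: "local_chordalization_partition G C Cs"
    and "i \<le> length Cs"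
  shows "verts (chain_Gstar G Cs i) = verts G - later_parts Cs i \<and>
    edges (chain_Gstar G Cs i) \<subseteq> Pow (verts (chain_Gstar G Cs i)) \<and>
    {e \<in> edges G. e \<inter> later_parts Cs i = {}} \<subseteq> edges (chain_Gstar G Cs i)"
  using assms(3)
proof (induction i)
  case 0
  have "e \<subseteq> verts G" if "e \<in> edges G" for e
    using G that by (auto simp: simple_graph_def)
  then show ?case by (auto simp: later_parts_0 chain_Gstar.simps)
next
  case (Suc i)
  let ?G = "chain_G G Cs (Suc i)"
  have i: "i < length Cs" using Suc.prems by simp
  note Ci = partition_part(1)[OF G P i] and fin = partition_part(2)[OF G P i]
    and NC = partition_part(3)[OF G P i]
  note IH = Suc.IH[OF less_imp_le_nat[OF i]]
  have disj: "Cs ! i \<inter> later_parts Cs (Suc i) = {}"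
    unfolding later_parts_def Int_UN_distrib using partition_part(4)[OF G P i] by simp
  have e_verts: "e \<subseteq> verts G" if "e \<in> edges G" for e
    using G that by (auto simp: simple_graph_def)
  have V: "verts ?G = verts G - later_parts Cs (Suc i)"
    using IH Ci disj i by (auto simp: chain_G_Suc(1) later_parts_Suc)
  have E: "edges ?G \<subseteq> Pow (verts ?G)"
  proof -
    have "edges (chain_Gstar G Cs i) \<subseteq> Pow (verts ?G)"
      using IH unfolding chain_G_Suc(1) by blast
    then show ?thesis using e_verts unfolding chain_G_Suc(2) V by blast
  qed
  have "{{v, w} | v w. v \<in> Cs ! i \<and> w \<noteq> v \<and> w \<in> \<Union>(holes_at ?G v)} \<subseteq> Pow (verts ?G)"
    by (auto simp: holes_at_def holes_def is_hole_def chain_G_Suc(1))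
  then have "edges (hat ?G (Cs ! i)) \<subseteq> Pow (verts ?G)"
    by (intro subset_trans[OF hat_bounds(3)[OF NC fin]] Un_least E)
  moreover have "{e \<in> edges G. e \<inter> later_parts Cs (Suc i) = {}} \<subseteq> edges (hat ?G (Cs ! i))"
    by (rule subset_trans[OF _ hat_bounds(2)[OF NC fin]]) (simp add: chain_G_Suc(2))
  ultimately show ?case
    using hat_bounds(1)[OF NC fin] V by (simp add: chain_Gstar.simps)
qed

text \<open>Descending one stage costs at most one vertex of \<open>Cs ! i\<close>. The other clique
  vertices in that part are set aside for the induction hypothesis and put back afterwards, as all
  their edges at this stage belong to \<open>G\<close>.\<close>

lemma chain_Gstar_clique:
  assumes G: "simple_graph G" and P: "local_chordalization_partition G C Cs"
    and "i \<le> length Cs" "clique (chain_Gstar G Cs i) K"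
  shows "\<exists>X \<subseteq> K \<inter> (\<Union>j<i. Cs ! j). clique G (K - X) \<and> (\<forall>j<i. card (X \<inter> Cs ! j) \<le> 1)"
  using assms(3,4)
proof (induction i arbitrary: K)
  case 0
  have "adj G a b" if "adj (chain_Gstar G Cs 0) a b" for a b
    using that by (simp add: chain_Gstar.simps adj_def)
  then have "clique G K" using 0 unfolding clique_def by blast
  then show ?case by auto
next
  case (Suc i)
  let ?G = "chain_G G Cs (Suc i)"
  have i: "i < length Cs" using Suc.prems by simp
  note fin = partition_part(2)[OF G P i] and NC = partition_part(3)[OF G P i]
    and disj = partition_part(4)[OF G P i] and inv = chain_Gstar_invariant[OF G P]
  have Ci: "Cs ! i \<subseteq> verts ?G" by (simp add: chain_G_Suc(1))
  obtain U where U: "U \<subseteq> K \<inter> Cs ! i" "card U \<le> 1" "clique ?G (K - U)"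
    using clique_hat[OF NC Ci fin] Suc.prems(2) unfolding chain_Gstar.simps by metis
  \<comment> \<open>An edge of \<open>G\<close> present at this stage and avoiding
    \<open>Cs ! i\<close> avoids all of \<open>later_parts Cs i\<close>, so it was there
    before.\<close>
  have old: "adj (chain_Gstar G Cs i) a b"
    if "adj ?G a b" "a \<notin> Cs ! i" "b \<notin> Cs ! i" for a b
    using that inv[of i] i unfolding adj_def chain_G_Suc(2) by (auto simp: later_parts_Suc)
  have new: "adj G a b" if "adj ?G a b" "a \<in> Cs ! i \<or> b \<in> Cs ! i" for a b
  proof -
    have "{a, b} \<notin> edges (chain_Gstar G Cs i)"
      using that(2) inv[of i] i by (auto simp: later_parts_Suc)
    then show ?thesis using that(1) by (auto simp: adj_def chain_G_Suc(2))
  qed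
  let ?K = "K - U - Cs ! i"
  have "clique (chain_Gstar G Cs i) ?K"
    using U(3) old by (auto simp: clique_def)
  then obtain X where X: "X \<subseteq> ?K \<inter> (\<Union>j<i. Cs ! j)" "clique G (?K - X)"
    "\<forall>j<i. card (X \<inter> Cs ! j) \<le> 1"
    using Suc.IH[of ?K] i by (meson less_imp_le_nat)
  have "clique G (K - (U \<union> X))"
    unfolding clique_def
  proof (intro ballI impI)
    fix a b assume ab: "a \<in> K - (U \<union> X)" "b \<in> K - (U \<union> X)" "a \<noteq> b"
    show "adj G a b"
    proof (cases "a \<in> Cs ! i \<or> b \<in> Cs ! i")
      case True
      then show ?thesis using ab U(3) new by (auto simp: clique_def)
    next
      case False
      then show ?thesis using ab X(2) by (auto simp: clique_def)
    qed
  qed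
  moreover have "card ((U \<union> X) \<inter> Cs ! j) \<le> 1" if "j < Suc i" for j
  proof (cases "j = i")
    case True
    then have "(U \<union> X) \<inter> Cs ! j = U" using U(1) X(1) by auto
    then show ?thesis using U(2) by simp
  next
    case False
    then have "(U \<union> X) \<inter> Cs ! j = X \<inter> Cs ! j" using U(1) disj[of j] that i by auto
    then show ?thesis using X(3) that False by simp
  qed
  moreover have "U \<union> X \<subseteq> K \<inter> (\<Union>j<Suc i. Cs ! j)"
    using U(1) X(1) by (auto simp: lessThan_Suc)
  ultimately show ?case by blast
qed

theorem theorem4p3:
  fixes G :: "'a graph" and C K :: "'a set" and Cs :: "'a set list"
  assumes "simple_graph G"
    and "hole_cover G C"
    and "local_chordalization_partition G C Cs"
    and "K \<subseteq> verts G"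
    and "clique (chain_Gstar G Cs (length Cs)) K"
  shows "\<exists>Cstar. Cstar \<subseteq> K \<inter> C \<and> clique G (K - Cstar) \<and>
           (\<forall>i<length Cs. card (Cstar \<inter> Cs ! i) \<le> 1)"
proof -
  have "(\<Union>j<length Cs. Cs ! j) = C"
    using assms(3) unfolding local_chordalization_partition_def ordered_partition_def
    by (auto simp: set_conv_nth)
  then show ?thesis
    using chain_Gstar_clique[OF assms(1,3) order_refl assms(5)] by auto
qed

end
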